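(* Let $X$ be a real Banach space, let $T:X\rightrightarrows X^{\ast}$ be a maximal monotone operator and let $\varphi\in\mathcal{H}(T)$. Define the bifunction $F:X\times X\to\overline{\mathbb{R}}$ by $$F(x,y)=\sup_{x^{\ast}\in X^{\ast}}\{\langle x^{\ast},y\rangle-\varphi^{\ast}(x^{\ast},x)\}.$$ Then: (a) $F$ is a saddle function such that $\mathrm{cl}_{2}F=F$; (b) $F$ is normal, and $\operatorname{co}D(T)\subseteq D(F)\subseteq\overline{\operatorname{co}}\,D(T)$; (c) $A^{F}={}^{F}\!A=T$; (d) $\varphi_{F}=\varphi$ and $\varphi^{F}=(\varphi^{\ast})^{t}$.
   Context: $X$ is a real Banach space, $X^{\ast}$ its topological dual endowed with the weak$^{\ast}$ topology, $\langle x^{\ast},x\rangle$ the duality product. $X\times X^{\ast}$ carries the product (norm $\times$ weak$^{\ast}$) topology, with dual $X^{\ast}\times X$ under $\langle(x^{\ast},x),(y,y^{\ast})\rangle=\langle x^{\ast},y\rangle+\langle y^{\ast},x\rangle$. $\overline{\mathbb{R}}=\mathbb{R}\cup\{-\infty,+\infty\}$. $\operatorname{co}$ and $\overline{\operatorname{co}}$ denote convex hull and closed convex hull. Functions: an $\overline{\mathbb{R}}$-valued function is convex if its epigraph $\{(x,\mu):\mu\in\mathbb{R},\ f(x)\le\mu\}$ is convex; $f$ is concave if $-f$ is convex. The closure $\overline f$ of a convex function $f$ is the pointwise supremum of all continuous affine functions majorized by $f$ (so $\overline f\equiv-\infty$ if there are none); $f$ is closed if $\overline f=f$. The closure of a concave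 $f$ is $-\overline{(-f)}$. Operators: $D(T)=\{x:T(x)\ne\emptyset\}$, $\operatorname{gph}T=\{(x,x^{\ast}):x^{\ast}\in T(x)\}$; $D(T)\neq\emptyset$ is assumed. $T$ is monotone if $\langle x^{\ast}-y^{\ast},x-y\rangle\ge0$ whenever $x^{\ast}\in T(x)$, $y^{\ast}\in T(y)$; it is maximal monotone if moreover its graph is not properly contained in the graph of another monotone operator. $\mathcal{H}(T)$, the class of representative functions of $T$, is the set of all closed convex $\varphi:X\times X^{\ast}\to\overline{\mathbb{R}}$ such that $\varphi(x,x^{\ast})\ge\langle x^{\ast},x\rangle$ for all $(x,x^{\ast})$, and $\varphi(x,x^{\ast})=\langle x^{\ast},x\rangle$ whenever $(x,x^{\ast})\in\operatorname{gph}T$. The conjugate of $\varphi$ is $\varphi^{\ast}(x^{\ast},x)=\sup_{(y,y^{\ast})\in X\times X^{\ast}}\big(\langle x^{\ast},y\rangle+\langle y^{\ast},x\rangle-\varphi(y,y^{\ast})\big)$ and $(\varphi^{\ast})^{t}(x,x^{\ast})=\varphi^{\ast}(x^{\ast},x)$. Bifunctions: a bifunction is any $F:X\times X\to\overline{\mathbb{R}}$. $F$ is normal if there is a nonempty set $C\subseteq X$ such that $F(x,y)=-\infty$ if and only if $x\notin C$; then $D(F):=C$. $F$ is a saddle function if it is concave in the first argument and convex in the second; $\mathrm{cl}_{2}F$ is the bifunction obtained by closing the convex function $F(x,\cdot)$ for every $x\in X$. $A^{F}(x)=\{x^{\ast}\in X^{\ast}:F(x,y)\ge\langle x^{\ast},y-x\rangle\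 \forall y\in X\}$ and ${}^{F}\!A(x)=\{x^{\ast}\in X^{\ast}:-F(y,x)\ge\langle x^{\ast},y-x\rangle\ \forall y\in X\}$. The Fitzpatrick transform of $F$ is $\varphi_{F}(x,x^{\ast})=\sup_{y\in X}(\langle x^{\ast},y\rangle+F(y,x))$ and the upper Fitzpatrick transform is $\varphi^{F}(x,x^{\ast})=\sup_{y\in X}(\langle x^{\ast},y\rangle-F(x,y))$. *)

theory Defs
  imports "HOL-Analysis.Analysis"
begin

text \<open>The dual of a Banach space \<open>'a\<close> is the type \<open>'a \<Rightarrow>\<^sub>L real\<close>; the duality product is the
  application of a bounded linear functional. The norm topology built into that type is not used.\<close>

text \<open>The type class topology on \<open>'a \<Rightarrow> real\<close> is that of pointwise convergence.\<close>

definition weak_star :: "('a::real_normed_vector \<Rightarrow>\<^sub>L real) topology" where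
  "weak_star = pullback_topology UNIV blinfun_apply euclidean"

definition norm_weak_star ::
    "('a::real_normed_vector \<times> ('a \<Rightarrow>\<^sub>L real)) topology" where
  "norm_weak_star = prod_topology euclidean weak_star"


definition convex_fun :: "('v::real_vector \<Rightarrow> ereal) \<Rightarrow> bool" where
  "convex_fun f \<longleftrightarrow> convex {(x, \<mu>::real). f x \<le> ereal \<mu>}"

definition concave_fun :: "('v::real_vector \<Rightarrow> ereal) \<Rightarrow> bool" where
  "concave_fun f \<longleftrightarrow> convex_fun (\<lambda>x. - f x)"

definition affine_fun :: "('v::real_vector \<Rightarrow> real) \<Rightarrow> bool" where
  "affine_fun g \<longleftrightarrow> (\<exists>l c. linear l \<and> g = (\<lambda>x. l x + c))"

text \<open>The supremum over the empty set is \<open>-\<infinity>\<close> in \<open>ereal\<close>.\<close>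

definition fun_closure ::
    "'v::real_vector topology \<Rightarrow> ('v \<Rightarrow> ereal) \<Rightarrow> 'v \<Rightarrow> ereal" where
  "fun_closure \<tau> f x =
     (SUP g \<in> {g. affine_fun g \<and> continuous_map \<tau> euclideanreal g \<and> (\<forall>z. ereal (g z) \<le> f z)}.
        ereal (g x))"

definition closed_fun :: "'v::real_vector topology \<Rightarrow> ('v \<Rightarrow> ereal) \<Rightarrow> bool" where
  "closed_fun \<tau> f \<longleftrightarrow> fun_closure \<tau> f = f"


definition op_dom :: "('a::real_normed_vector \<Rightarrow> ('a \<Rightarrow>\<^sub>L real) set) \<Rightarrow> 'a set" where
  "op_dom T = {x. T x \<noteq> {}}"

definition gph :: "('a::real_normed_vector \<Rightarrow> ('a \<Rightarrow>\<^sub>L real) set) \<Rightarrow> ('a \<times> ('a \<Rightarrow>\<^sub>L real)) set" where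
  "gph T = {(x, xs). xs \<in> T x}"

definition monotone_op :: "('a::real_normed_vector \<Rightarrow> ('a \<Rightarrow>\<^sub>L real) set) \<Rightarrow> bool" where
  "monotone_op T \<longleftrightarrow>
     (\<forall>x y. \<forall>xs \<in> T x. \<forall>ys \<in> T y. blinfun_apply (xs - ys) (x - y) \<ge> 0)"

definition maximal_monotone_op :: "('a::real_normed_vector \<Rightarrow> ('a \<Rightarrow>\<^sub>L real) set) \<Rightarrow> bool" where
  "maximal_monotone_op T \<longleftrightarrow> monotone_op T \<and> \<not> (\<exists>S. monotone_op S \<and> gph T \<subset> gph S)"

definition representatives ::
    "('a::real_normed_vector \<Rightarrow> ('a \<Rightarrow>\<^sub>L real) set) \<Rightarrow> ('a \<times> ('a \<Rightarrow>\<^sub>L real) \<Rightarrow> ereal) set" where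
  "representatives T =
     {\<phi>. convex_fun \<phi> \<and> closed_fun norm_weak_star \<phi> \<and>
         (\<forall>x xs. \<phi> (x, xs) \<ge> ereal (blinfun_apply xs x)) \<and>
         (\<forall>(x, xs) \<in> gph T. \<phi> (x, xs) = ereal (blinfun_apply xs x))}"

definition conjugate ::
    "('a::real_normed_vector \<times> ('a \<Rightarrow>\<^sub>L real) \<Rightarrow> ereal) \<Rightarrow> ('a \<Rightarrow>\<^sub>L real) \<times> 'a \<Rightarrow> ereal" where
  "conjugate \<phi> = (\<lambda>(xs, x).
     SUP (y, ys) \<in> UNIV. ereal (blinfun_apply xs y + blinfun_apply ys x) - \<phi> (y, ys))"


definition normal_bif :: "('a \<Rightarrow> 'a \<Rightarrow> ereal) \<Rightarrow> bool" where
  "normal_bif F \<longleftrightarrow> (\<exists>C. C \<noteq> {} \<and> (\<forall>x y. F x y = -\<infinity> \<longleftrightarrow> x \<notin> C))"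

text \<open>Meaningful only for normal bifunctions, for which the set \<open>C\<close> is unique.\<close>

definition bif_dom :: "('a \<Rightarrow> 'a \<Rightarrow> ereal) \<Rightarrow> 'a set" where
  "bif_dom F = (THE C. C \<noteq> {} \<and> (\<forall>x y. F x y = -\<infinity> \<longleftrightarrow> x \<notin> C))"

definition saddle_fun :: "('a::real_vector \<Rightarrow> 'a \<Rightarrow> ereal) \<Rightarrow> bool" where
  "saddle_fun F \<longleftrightarrow> (\<forall>y. concave_fun (\<lambda>x. F x y)) \<and> (\<forall>x. convex_fun (\<lambda>y. F x y))"

definition cl2 :: "('a::real_normed_vector \<Rightarrow> 'a \<Rightarrow> ereal) \<Rightarrow> 'a \<Rightarrow> 'a \<Rightarrow> ereal" where
  "cl2 F x = fun_closure euclidean (F x)"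

text \<open>The operators \<open>A\<^sup>F\<close> and \<open>\<^sup>FA\<close>, in this order.\<close>

definition right_op ::
    "('a::real_normed_vector \<Rightarrow> 'a \<Rightarrow> ereal) \<Rightarrow> 'a \<Rightarrow> ('a \<Rightarrow>\<^sub>L real) set" where
  "right_op F x = {xs. \<forall>y. F x y \<ge> ereal (blinfun_apply xs (y - x))}"

definition left_op ::
    "('a::real_normed_vector \<Rightarrow> 'a \<Rightarrow> ereal) \<Rightarrow> 'a \<Rightarrow> ('a \<Rightarrow>\<^sub>L real) set" where
  "left_op F x = {xs. \<forall>y. - F y x \<ge> ereal (blinfun_apply xs (y - x))}"

text \<open>The transforms \<open>\<phi>\<^sub>F\<close> and \<open>\<phi>\<^sup>F\<close>, in this order.\<close>

definition fitzpatrick ::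
    "('a::real_normed_vector \<Rightarrow> 'a \<Rightarrow> ereal) \<Rightarrow> 'a \<times> ('a \<Rightarrow>\<^sub>L real) \<Rightarrow> ereal" where
  "fitzpatrick F = (\<lambda>(x, xs). SUP y. ereal (blinfun_apply xs y) + F y x)"

definition upper_fitzpatrick ::
    "('a::real_normed_vector \<Rightarrow> 'a \<Rightarrow> ereal) \<Rightarrow> 'a \<times> ('a \<Rightarrow>\<^sub>L real) \<Rightarrow> ereal" where
  "upper_fitzpatrick F = (\<lambda>(x, xs). SUP y. ereal (blinfun_apply xs y) - F x y)"

end

theory Submission
  imports Defs
begin

text \<open>Write \<open>\<pi> (x, xs) = xs x\<close> for the duality product and \<open>h\<close> for the
Fitzpatrick function of \<open>T\<close>, the supremum of \<open>xs y + ys x - ys y\<close> over the graph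
points \<open>(y, ys)\<close>. Two kinds of facts combine.

The first kind is pure conjugacy. The bifunction \<open>F\<close> is the conjugate of
\<open>\<phi>\<^sup>*\<close> in its dual variable alone (\<open>partial_conjugate\<close>). Since
\<open>\<phi>\<^sup>*\<close> is jointly convex, \<open>F\<close> is concave in \<open>x\<close>; in
\<open>y\<close> it is a supremum of continuous affine functions, so it is convex and equal to its closure.
The upper transform of \<open>F\<close> conjugates back and returns \<open>\<phi>\<^sup>*\<close>; the lower
transform conjugates in the remaining variable and gives \<open>\<phi>\<^sup>*\<^sup>*\<close>, which is
\<open>\<phi>\<close> because \<open>\<phi>\<close> is closed and the continuous affine functions on
\<open>X \<times> X\<^sup>*\<close> all come from \<open>X\<^sup>* \<times> X\<close>
(\<open>continuous_affine_norm_weak_star\<close>). Moreover \<open>F x y = -\<infinity>\<close> happens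
precisely when \<open>\<phi>\<^sup>*\<close> is identically \<open>\<infinity>\<close> on the slice at
\<open>x\<close>, so the domain of \<open>F\<close> is the projection of the effective domain of
\<open>\<phi>\<^sup>*\<close>, a convex set.

The second kind ties \<open>\<phi>\<close> to \<open>T\<close>. Both \<open>\<phi>\<close> and the
transposed \<open>\<phi>\<^sup>*\<close> dominate \<open>h\<close>: the latter because
\<open>\<phi> = \<pi>\<close> on the graph, the former by comparing, along a segment that starts in the
graph, the convex function \<open>\<phi>\<close> with \<open>\<pi>\<close>
(\<open>representative_ge\<close>). Maximality says that \<open>h \<le> \<pi>\<close> holds at graph points
only, and both \<open>\<phi>\<close> and the transposed \<open>\<phi>\<^sup>*\<close> are at most
\<open>\<pi>\<close> on the graph. Hence each of them is at most \<open>\<pi>\<close> exactly on the graph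
of \<open>T\<close>. As the operators \<open>right_op F\<close> and \<open>left_op F\<close> consist of the
points where the transforms of \<open>F\<close> are at most \<open>\<pi>\<close>, both operators are
\<open>T\<close>.

For the domain, graph points have finite \<open>\<phi>\<^sup>*\<close>, so the projection contains the
domain of \<open>T\<close> and its convex hull. Conversely, finiteness of \<open>\<phi>\<^sup>*\<close>,
hence of \<open>h\<close>, at some point over \<open>x\<close> puts \<open>x\<close> in the closed convex
hull of the domain (\<open>maximal_monotone_bound_imp_closure_dom\<close>). This step needs the separation
of a point from a closed convex set, which is derived from the Mazur--Orlicz theorem: sublinear functionals
that are minimal in the pointwise order are linear.\<close>

section \<open>Sublinear functionals and separation in normed spaces\<close>

definition sublinear :: "('v::real_vector \<Rightarrow> real) \<Rightarrow> bool" where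
  "sublinear p \<longleftrightarrow> (\<forall>x y. p (x + y) \<le> p x + p y) \<and> (\<forall>t\<ge>0. \<forall>x. p (t *\<^sub>R x) = t * p x)"

lemma sublinear_add: "sublinear p \<Longrightarrow> p (x + y) \<le> p x + p y"
  and sublinear_scale: "sublinear p \<Longrightarrow> t \<ge> 0 \<Longrightarrow> p (t *\<^sub>R x) = t * p x"
  by (auto simp: sublinear_def)

lemma sublinear_zero: "sublinear p \<Longrightarrow> p 0 = 0"
  using sublinear_scale[of p 0 0] by simp

lemma sublinear_minus: "sublinear p \<Longrightarrow> - p (- x) \<le> p x"
  using sublinear_add[of p x "- x"] sublinear_zero[of p] by simp

lemma sublinearI:
  assumes "p 0 = 0" and "\<And>x y. p (x + y) \<le> p x + p y"
    and le: "\<And>t x. t > 0 \<Longrightarrow> p (t *\<^sub>R x) \<le> t * p x"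
  shows "sublinear p"
  unfolding sublinear_def
proof (intro conjI allI impI)
  fix t :: real and x
  assume "t \<ge> 0"
  show "p (t *\<^sub>R x) = t * p x"
  proof (cases "t = 0")
    case False
    then have "t > 0" using \<open>t \<ge> 0\<close> by simp
    then have "p x \<le> inverse t * p (t *\<^sub>R x)"
      using le[of "inverse t" "t *\<^sub>R x"] by simp
    then have "t * p x \<le> p (t *\<^sub>R x)"
      using \<open>t > 0\<close> by (simp add: field_simps)
    then show ?thesis using le[OF \<open>t > 0\<close>, of x] by linarith
  qed (use assms in simp)
qed (use assms in simp)

text \<open>This is the one-step improvement behind every Hahn--Banach argument. A linear functional
\<open>l \<le> p\<close> with \<open>l \<ge> \<beta>\<close> on \<open>K\<close> satisfies
\<open>l v = l (v + t k) - t (l k) \<le> p (v + t k) - t \<beta>\<close> for all \<open>t \<ge> 0\<close>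
and \<open>k \<in> K\<close>; the infimum of the right-hand sides is therefore the natural upper bound for
such an \<open>l\<close>. It is finite because \<open>\<beta> \<le> p\<close> on \<open>K\<close> and
sublinear because \<open>K\<close> is convex, and it encodes the demand on \<open>K\<close> in a form that
passes to every smaller functional.\<close>

lemma sublinear_tilt:
  assumes p: "sublinear p" and K: "convex K" "K \<noteq> {}" and \<beta>: "\<And>k. k \<in> K \<Longrightarrow> \<beta> \<le> p k"
  obtains q where "sublinear q" "\<And>v. q v \<le> p v" "\<And>k. k \<in> K \<Longrightarrow> q (- k) \<le> - \<beta>"
proof -
  \<comment> \<open>The value \<open>t = 0\<close> gives \<open>q \<le> p\<close>, and \<open>t = 1\<close> at the vector \<open>- k\<close> gives the bound on \<open>- K\<close>.\<close>
  define q where "q v = (INF (t, k)\<in>{0..} \<times> K. p (v + t *\<^sub>R k) - t * \<beta>)" for v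
  have \<beta>': "t * \<beta> \<le> p (t *\<^sub>R k)" if "t \<ge> 0" "k \<in> K" for t k
    using \<beta>[OF that(2)] that sublinear_scale[OF p] by (simp add: mult_left_mono)
  have lower: "- p (- v) \<le> p (v + t *\<^sub>R k) - t * \<beta>" if "t \<ge> 0" "k \<in> K" for v t k
    using \<beta>'[OF that] sublinear_add[OF p, of "v + t *\<^sub>R k" "- v"] by simp
  have q_le: "q v \<le> p (v + t *\<^sub>R k) - t * \<beta>" if "t \<ge> 0" "k \<in> K" for v t k
  proof -
    have "bdd_below ((\<lambda>(t, k). p (v + t *\<^sub>R k) - t * \<beta>) ` ({0..} \<times> K))"
      by (rule bdd_belowI2[of _ "- p (- v)"]) (use lower in auto)
    then show ?thesis
      unfolding q_def using cINF_lower[of _ _ "(t, k)"] that by fastforce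
  qed
  have le_q: "c \<le> q v" if "\<And>t k. t \<ge> 0 \<Longrightarrow> k \<in> K \<Longrightarrow> c \<le> p (v + t *\<^sub>R k) - t * \<beta>" for c v
    unfolding q_def using K(2) that by (intro cINF_greatest) auto
  have q_le_p: "q v \<le> p v" for v
    using q_le[of 0 _ v] K(2) by auto
  have "sublinear q"
  proof (rule sublinearI)
    have "0 \<le> q 0" using \<beta>' by (intro le_q) simp
    then show "q 0 = 0" using q_le_p[of 0] sublinear_zero[OF p] by simp
  next
    fix x y
    have *: "q (x + y) \<le> (p (x + s *\<^sub>R k) - s * \<beta>) + (p (y + t *\<^sub>R l) - t * \<beta>)"
      if st: "s \<ge> 0" "t \<ge> 0" and kl: "k \<in> K" "l \<in> K" for s t k l
    proof -
      \<comment> \<open>Convexity of \<open>K\<close> merges the two increments into a single one.\<close>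
      have "\<exists>m\<in>K. (s + t) *\<^sub>R m = s *\<^sub>R k + t *\<^sub>R l"
      proof (cases "s + t = 0")
        case True
        then have "s = 0" "t = 0" using st by auto
        then show ?thesis using kl by auto
      next
        case False
        let ?m = "(s / (s + t)) *\<^sub>R k + (t / (s + t)) *\<^sub>R l"
        have "?m \<in> K"
          using st kl False by (intro convexD[OF K(1)]) (auto simp: add_divide_distrib[symmetric])
        moreover have "(s + t) *\<^sub>R ?m = s *\<^sub>R k + t *\<^sub>R l"
          using False by (simp add: scaleR_add_right)
        ultimately show ?thesis by blast
      qed
      then obtain m where m: "m \<in> K" "(s + t) *\<^sub>R m = s *\<^sub>R k + t *\<^sub>R l" by blast
      have "q (x + y) \<le> p ((x + y) + (s + t) *\<^sub>R m) - (s + t) * \<beta>"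
        using st m by (intro q_le) auto
      also have "(x + y) + (s + t) *\<^sub>R m = (x + s *\<^sub>R k) + (y + t *\<^sub>R l)"
        using m(2) by simp
      also have "p \<dots> \<le> p (x + s *\<^sub>R k) + p (y + t *\<^sub>R l)" by (rule sublinear_add[OF p])
      finally show ?thesis by (simp add: algebra_simps)
    qed
    have "q (x + y) - (p (x + s *\<^sub>R k) - s * \<beta>) \<le> q y" if "s \<ge> 0" "k \<in> K" for s k
      using *[OF that(1) _ that(2)] by (intro le_q) (simp add: algebra_simps)
    then have "q (x + y) - q y \<le> q x" by (intro le_q) (simp add: algebra_simps)
    then show "q (x + y) \<le> q x + q y" by simp
  next
    fix c :: real and x
    assume c: "c > 0"
    have "q (c *\<^sub>R x) / c \<le> q x"
    proof (rule le_q)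
      fix t :: real and k assume t: "t \<ge> 0" "k \<in> K"
      have "q (c *\<^sub>R x) \<le> p (c *\<^sub>R x + (c * t) *\<^sub>R k) - (c * t) * \<beta>"
        using t c by (intro q_le) auto
      also have "c *\<^sub>R x + (c * t) *\<^sub>R k = c *\<^sub>R (x + t *\<^sub>R k)"
        by (simp add: scaleR_add_right)
      also have "p \<dots> = c * p (x + t *\<^sub>R k)"
        using c by (intro sublinear_scale[OF p]) simp
      finally show "q (c *\<^sub>R x) / c \<le> p (x + t *\<^sub>R k) - t * \<beta>"
        using c by (simp add: field_simps)
    qed
    then show "q (c *\<^sub>R x) \<le> c * q x" using c by (simp add: field_simps)
  qed
  moreover have "q (- k) \<le> - \<beta>" if "k \<in> K" for k
    using q_le[of 1 k "- k"] that sublinear_zero[OF p] by simp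
  ultimately show thesis using that q_le_p by blast
qed

text \<open>The pointwise infimum is finite because a sublinear \<open>q \<le> p\<close> is bounded below by
\<open>- p (- x)\<close> at \<open>x\<close>. Subadditivity survives because two members of a chain can be
replaced by the smaller one.\<close>

lemma sublinear_chain_Inf:
  assumes ne: "C \<noteq> {}" and sub: "\<And>q. q \<in> C \<Longrightarrow> sublinear q"
    and le: "\<And>q x. q \<in> C \<Longrightarrow> q x \<le> p x"
    and chain: "\<And>q r. q \<in> C \<Longrightarrow> r \<in> C \<Longrightarrow> q \<le> r \<or> r \<le> q"
  obtains u where "sublinear u" "\<And>q. q \<in> C \<Longrightarrow> u \<le> q"
proof -
  define u where "u x = (INF q\<in>C. q x)" for x
  have u_le: "u x \<le> q x" if "q \<in> C" for q x
  proof -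
    have "- p (- x) \<le> r x" if "r \<in> C" for r
      using sublinear_minus[OF sub[OF that], of x] le[OF that, of "- x"] by simp
    then have "bdd_below ((\<lambda>q. q x) ` C)" by (intro bdd_belowI2[of _ "- p (- x)"]) auto
    then show ?thesis unfolding u_def using that by (intro cINF_lower)
  qed
  have le_u: "c \<le> u x" if "\<And>q. q \<in> C \<Longrightarrow> c \<le> q x" for c x
    unfolding u_def using ne that by (intro cINF_greatest)
  have "sublinear u"
  proof (rule sublinearI)
    have "u 0 = (INF q\<in>C. 0)" unfolding u_def using sublinear_zero[OF sub] by (intro INF_cong) auto
    then show "u 0 = 0" using ne by simp
  next
    fix x y
    have *: "u (x + y) \<le> q x + r y" if qr: "q \<in> C" "r \<in> C" for q r
    proof -
      obtain s where s: "s \<in> C" "s \<le> q" "s \<le> r" using chain[OF qr] qr by auto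
      have "u (x + y) \<le> s (x + y)" by (rule u_le[OF s(1)])
      also have "\<dots> \<le> s x + s y" by (rule sublinear_add[OF sub[OF s(1)]])
      also have "\<dots> \<le> q x + r y" using s by (intro add_mono) (auto simp: le_fun_def)
      finally show ?thesis .
    qed
    have "u (x + y) - q x \<le> u y" if "q \<in> C" for q
      using *[OF that] by (intro le_u) (simp add: algebra_simps)
    then have "u (x + y) - u y \<le> u x" by (intro le_u) (simp add: algebra_simps)
    then show "u (x + y) \<le> u x + u y" by simp
  next
    fix t :: real and x
    assume t: "t > 0"
    have "u (t *\<^sub>R x) / t \<le> u x"
    proof (rule le_u)
      fix q assume q: "q \<in> C"
      show "u (t *\<^sub>R x) / t \<le> q x"
        using u_le[OF q, of "t *\<^sub>R x"] sublinear_scale[OF sub[OF q], of t x] t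
        by (simp add: field_simps)
    qed
    then show "u (t *\<^sub>R x) \<le> t * u x" using t by (simp add: field_simps)
  qed
  then show thesis using that u_le by (simp add: le_fun_def)
qed

lemma ex_minimal_sublinear:
  assumes "sublinear p"
  obtains q where "sublinear q" "q \<le> p" "\<And>r. sublinear r \<Longrightarrow> r \<le> q \<Longrightarrow> r = q"
proof -
  let ?A = "{q. sublinear q \<and> q \<le> p}"
  have "\<exists>m\<in>?A. \<forall>a\<in>?A. m \<ge> a \<longrightarrow> a = m"
  proof (rule predicate_Zorn)
    show "partial_order_on ?A (relation_of (\<ge>) ?A)"
      by (rule partial_order_on_relation_ofI) auto
  next
    fix C assume C: "C \<in> Chains (relation_of (\<ge>) ?A)"
    then have CA: "C \<subseteq> ?A" and ch: "\<And>q r. q \<in> C \<Longrightarrow> r \<in> C \<Longrightarrow> q \<le> r \<or> r \<le> q"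
      by (auto simp: Chains_def relation_of_def)
    show "\<exists>u\<in>?A. \<forall>a\<in>C. a \<ge> u"
    proof (cases "C = {}")
      case True
      then show ?thesis using assms by auto
    next
      case False
      obtain u where "sublinear u" "\<And>q. q \<in> C \<Longrightarrow> u \<le> q"
        by (rule sublinear_chain_Inf[of C p]) (use False CA ch in \<open>auto simp: le_fun_def\<close>)
      moreover then have "u \<le> p" using False CA by force
      ultimately show ?thesis by auto
    qed
  qed
  then obtain q where "sublinear q" "q \<le> p" "\<And>r. sublinear r \<Longrightarrow> r \<le> p \<Longrightarrow> r \<le> q \<Longrightarrow> r = q"
    by auto
  then show thesis using that order_trans by metis
qed

text \<open>Tilting a minimal \<open>q\<close> along the single vector \<open>y\<close> with
\<open>\<beta> = q y\<close> cannot change it, which forces \<open>q (- y) \<le> - q y\<close>. So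
\<open>q\<close> is odd, and an odd sublinear functional is linear.\<close>

lemma minimal_sublinear_linear:
  assumes q: "sublinear q" and min: "\<And>r. sublinear r \<Longrightarrow> r \<le> q \<Longrightarrow> r = q"
  shows "linear q"
proof -
  have minus: "q (- y) = - q y" for y
  proof -
    obtain r where r: "sublinear r" "\<And>v. r v \<le> q v" "\<And>k. k \<in> {y} \<Longrightarrow> r (- k) \<le> - q y"
      by (rule sublinear_tilt[OF q, of "{y}" "q y"]) auto
    then have "r = q" using min by (simp add: le_fun_def)
    then show ?thesis using r(3)[of y] sublinear_minus[OF q, of y] by simp
  qed
  show ?thesis
  proof (rule linearI)
    fix x y
    have "- q (x + y) \<le> - q x - q y"
      using sublinear_add[OF q, of "- x" "- y"] minus[of "x + y"] minus[of x] minus[of y]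
      by (simp add: add.commute)
    then show "q (x + y) = q x + q y" using sublinear_add[OF q, of x y] by simp
  next
    fix t :: real and x
    show "q (t *\<^sub>R x) = t *\<^sub>R q x"
    proof (cases "t \<ge> 0")
      case False
      have "q (t *\<^sub>R x) = - q ((- t) *\<^sub>R x)" using minus[of "t *\<^sub>R x"] by simp
      then show ?thesis using sublinear_scale[OF q, of "- t" x] False by simp
    qed (simp add: sublinear_scale[OF q])
  qed
qed

text \<open>The Mazur--Orlicz form of the Hahn--Banach theorem: tilt \<open>p\<close> along
\<open>K\<close>, then pass to a minimal sublinear functional below the result. The bound on
\<open>K\<close> is recovered from the values at \<open>- k\<close>.\<close>

theorem mazur_orlicz:
  assumes "sublinear p" "convex K" "K \<noteq> {}" "\<And>k. k \<in> K \<Longrightarrow> \<beta> \<le> p k"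
  obtains l where "linear l" "\<And>v. l v \<le> p v" "\<And>k. k \<in> K \<Longrightarrow> \<beta> \<le> l k"
proof -
  obtain q where q: "sublinear q" "\<And>v. q v \<le> p v" "\<And>k. k \<in> K \<Longrightarrow> q (- k) \<le> - \<beta>"
    using sublinear_tilt[OF assms] by metis
  obtain l where l: "sublinear l" "l \<le> q" "\<And>r. sublinear r \<Longrightarrow> r \<le> l \<Longrightarrow> r = l"
    using ex_minimal_sublinear[OF q(1)] by metis
  have lin: "linear l" using minimal_sublinear_linear l by blast
  have "l v \<le> p v" for v using l(2) q(2)[of v] by (auto simp: le_fun_def intro: order_trans)
  moreover have "\<beta> \<le> l k" if "k \<in> K" for k
    using q(3)[OF that] le_funD[OF l(2), of "- k"] linear_neg[OF lin, of k] by simp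
  ultimately show thesis using that lin by blast
qed

text \<open>Apply Mazur--Orlicz to the norm and the set \<open>x - C\<close>, on which the norm is at least
the radius \<open>\<delta>\<close> of a ball around \<open>x\<close> that misses \<open>C\<close>. The
functional obtained lies below the norm, hence is bounded.\<close>

theorem separate_point_closed_convex:
  fixes C :: "'a::real_normed_vector set"
  assumes C: "convex C" "closed C" and x: "x \<notin> C"
  obtains u :: "'a \<Rightarrow>\<^sub>L real" and \<delta> where "\<delta> > 0" "\<And>y. y \<in> C \<Longrightarrow> \<delta> \<le> u (x - y)"
proof (cases "C = {}")
  case True
  then show thesis using that[of 1 0] by simp
next
  case False
  obtain \<delta> where \<delta>: "\<delta> > 0" "\<And>y. y \<in> C \<Longrightarrow> \<delta> \<le> dist x y"
    using C(2) x unfolding closed_def open_contains_ball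
    by (metis ComplD ComplI mem_ball not_le subsetD)
  obtain l where l: "linear l" "\<And>v. l v \<le> norm v" "\<And>k. k \<in> (\<lambda>y. x - y) ` C \<Longrightarrow> \<delta> \<le> l k"
  proof (rule mazur_orlicz)
    show "sublinear (norm :: 'a \<Rightarrow> real)"
      by (auto simp: sublinear_def norm_triangle_ineq)
    show "convex ((\<lambda>y. x - y) ` C)"
      using convex_translation[OF convex_negations[OF C(1)], of x] by (simp add: image_image)
  qed (use False \<delta> in \<open>auto simp: dist_norm\<close>)
  have "\<bar>l v\<bar> \<le> norm v" for v
    using l(2)[of v] l(2)[of "- v"] linear_neg[OF l(1), of v] by simp
  then have "bounded_linear l"
    using l(1) by (intro bounded_linear_intro[of l 1]) (auto simp: linear_add linear_scale)
  then have "blinfun_apply (Blinfun l) = l" by (rule bounded_linear_Blinfun_apply)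
  then show thesis using that[of \<delta> "Blinfun l"] \<delta>(1) l(3) by auto
qed

section \<open>Continuous affine functions for the norm and weak-star topologies\<close>

text \<open>Linear algebra: a linear form on the dual that vanishes on the common kernel of finitely many
evaluations is a linear combination of them, and hence itself an evaluation. Each step of the induction
subtracts from \<open>l\<close> the multiple of the evaluation at \<open>i\<close> that makes the difference
vanish on the larger common kernel belonging to \<open>I\<close>.\<close>

lemma eval_of_vanishing:
  fixes l :: "('a::real_normed_vector \<Rightarrow>\<^sub>L real) \<Rightarrow> real"
  assumes "finite I" "linear l"
    and "\<And>f. (\<And>i. i \<in> I \<Longrightarrow> blinfun_apply f i = 0) \<Longrightarrow> l f = 0"
  shows "\<exists>x. \<forall>f. l f = blinfun_apply f x"
  using assms
proof (induction I arbitrary: l rule: finite_induct)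
  case empty
  then have "l f = blinfun_apply f 0" for f by (simp add: blinfun.zero_right)
  then show ?case by blast
next
  case (insert i I)
  show ?case
  proof (cases "\<forall>f :: 'a \<Rightarrow>\<^sub>L real. (\<forall>j\<in>I. blinfun_apply f j = 0) \<longrightarrow> blinfun_apply f i = 0")
    case True
    have "l f = 0" if f: "\<And>j. j \<in> I \<Longrightarrow> blinfun_apply f j = 0" for f
    proof -
      have "blinfun_apply f i = 0" using True f by simp
      then have "blinfun_apply f j = 0" if "j \<in> insert i I" for j
        using f that by (cases "j = i") auto
      then show ?thesis by (rule insert.prems(2))
    qed
    then show ?thesis using insert.IH[OF insert.prems(1)] by blast
  next
    case False
    then obtain f0 :: "'a \<Rightarrow>\<^sub>L real" where f0: "\<And>j. j \<in> I \<Longrightarrow> blinfun_apply f0 j = 0" "blinfun_apply f0 i \<noteq> 0"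
      by blast
    define c where "c = l f0 / blinfun_apply f0 i"
    let ?l = "\<lambda>f. l f - c * blinfun_apply f i"
    have "linear ?l"
      using insert.prems(1)
      by (intro linearI) (auto simp: linear_add linear_scale blinfun.add_left blinfun.scaleR_left algebra_simps)
    moreover have "?l f = 0" if f: "\<And>j. j \<in> I \<Longrightarrow> blinfun_apply f j = 0" for f
    proof -
      let ?s = "blinfun_apply f i / blinfun_apply f0 i"
      have "l (f - ?s *\<^sub>R f0) = 0"
        using f f0 by (intro insert.prems(2)) (auto simp: blinfun.diff_left blinfun.scaleR_left)
      then show ?thesis
        using insert.prems(1) by (simp add: linear_diff linear_scale c_def)
    qed
    ultimately obtain x where "\<forall>f. ?l f = blinfun_apply f x" using insert.IH by blast
    then have "\<forall>f. l f = blinfun_apply f (x + c *\<^sub>R i)"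
      by (simp add: blinfun.add_right blinfun.scaleR_right algebra_simps)
    then show ?thesis by blast
  qed
qed

lemma linear_eq_0_if_bounded:
  fixes l :: "'v::real_vector \<Rightarrow> real"
  assumes l: "linear l" and bd: "\<And>c. \<bar>l (c *\<^sub>R v)\<bar> < 1"
  shows "l v = 0"
proof (rule ccontr)
  assume "l v \<noteq> 0"
  then show False using bd[of "inverse (l v)"] l by (simp add: linear_scale)
qed

text \<open>The set where \<open>\<bar>l\<bar> < 1\<close> contains a basic neighbourhood of
\<open>0\<close>, which restricts the values at finitely many points only. If \<open>f\<close> vanishes at
these points, all its multiples lie in that neighbourhood, so \<open>l f = 0\<close>.\<close>

lemma weak_star_continuous_linear:
  assumes l: "linear l" and cont: "continuous_map weak_star euclideanreal l"
  shows "\<exists>x. \<forall>f. l f = blinfun_apply f x"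
proof -
  have "openin weak_star {f \<in> topspace weak_star. l f \<in> {-1<..<1}}"
    by (rule openin_continuous_map_preimage[OF cont]) simp
  then obtain U where U: "open U" "{f. l f \<in> {-1<..<1}} = blinfun_apply -` U"
    by (auto simp: weak_star_def openin_pullback_topology topspace_pullback_topology)
  have "0 \<in> {f. l f \<in> {-1<..<1}}" using linear_0[OF l] by simp
  then have "blinfun_apply 0 \<in> U" using U(2) by auto
  then obtain X where X: "blinfun_apply 0 \<in> (\<Pi>\<^sub>E i\<in>UNIV. X i)" "finite {i. X i \<noteq> UNIV}"
      "(\<Pi>\<^sub>E i\<in>UNIV. X i) \<subseteq> U"
    using product_topology_open_contains_basis[of "\<lambda>i. euclidean" UNIV U "blinfun_apply 0"] U(1)
    by (auto simp: euclidean_product_topology)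
  show ?thesis
  proof (rule eval_of_vanishing[OF X(2) l])
    fix f :: "'a \<Rightarrow>\<^sub>L real" assume f: "\<And>i. i \<in> {i. X i \<noteq> UNIV} \<Longrightarrow> blinfun_apply f i = 0"
    have "blinfun_apply (c *\<^sub>R f) \<in> (\<Pi>\<^sub>E i\<in>UNIV. X i)" for c :: real
    proof -
      have "c * blinfun_apply f i \<in> X i" for i
        using f[of i] X(1) by (cases "X i = UNIV") (auto simp: PiE_iff)
      then show ?thesis by (simp add: PiE_iff blinfun.scaleR_left)
    qed
    then have "blinfun_apply (c *\<^sub>R f) \<in> U" for c using X(3) by (rule subsetD[rotated])
    then have "c *\<^sub>R f \<in> {f. l f \<in> {-1<..<1}}" for c unfolding U(2) by simp
    then have "\<bar>l (c *\<^sub>R f)\<bar> < 1" for c by (auto simp: abs_less_iff)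
    then show "l f = 0" by (rule linear_eq_0_if_bounded[OF l])
  qed
qed

lemma continuous_linear_bounded:
  fixes l :: "'a::real_normed_vector \<Rightarrow> real"
  assumes l: "linear l" and cont: "continuous_on UNIV l"
  shows "bounded_linear l"
proof -
  have "isCont l 0" using cont by (simp add: continuous_on_eq_continuous_at)
  then obtain d where d: "d > 0" "\<And>x. norm x < d \<Longrightarrow> \<bar>l x\<bar> < 1"
    using linear_0[OF l] unfolding continuous_at_eps_delta
    by (metis dist_0_norm dist_commute dist_norm real_norm_def zero_less_one diff_zero)
  have "\<bar>l x\<bar> \<le> norm x * (2 / d)" for x
  proof (cases "x = 0")
    case False
    \<comment> \<open>The factor moves \<open>x\<close> to norm \<open>d / 2\<close>, strictly inside the ball where \<open>\<bar>l\<bar> < 1\<close>.\<close>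
    let ?c = "d / (2 * norm x)"
    have c: "?c > 0" using d(1) False by simp
    have "norm (?c *\<^sub>R x) < d" using d(1) False by simp
    then have "\<bar>l (?c *\<^sub>R x)\<bar> < 1" by (rule d(2))
    then have "?c * \<bar>l x\<bar> < 1" using c
      by (simp only: linear_scale[OF l] real_scaleR_def abs_mult abs_of_pos)
    then show ?thesis using d(1) False by (simp add: field_simps)
  qed (simp add: linear_0[OF l])
  then show ?thesis
    using l by (intro bounded_linear_intro[of l "2 / d"]) (auto simp: linear_add linear_scale)
qed

text \<open>The dual of \<open>X \<times> X\<^sup>*\<close>, with the weak-star topology on the second
factor, is \<open>X\<^sup>* \<times> X\<close>. This is the reason why biconjugation in this duality
reproduces functions that are suprema of continuous affine functions.\<close>

lemma continuous_affine_norm_weak_star: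
  fixes g :: "'a::real_normed_vector \<times> ('a \<Rightarrow>\<^sub>L real) \<Rightarrow> real"
  assumes "affine_fun g" and cont: "continuous_map norm_weak_star euclideanreal g"
  shows "\<exists>xs x c. \<forall>y ys. g (y, ys) = blinfun_apply xs y + blinfun_apply ys x + c"
proof -
  obtain l c where l: "linear l" and g: "g = (\<lambda>z. l z + c)"
    using assms(1) by (auto simp: affine_fun_def)
  have "continuous_map norm_weak_star euclideanreal (\<lambda>z. g z - c)"
    by (intro continuous_intros cont)
  then have lc: "continuous_map norm_weak_star euclideanreal l" by (simp add: g)
  have UN: "topspace (weak_star :: ('a \<Rightarrow>\<^sub>L real) topology) = UNIV"
    by (simp add: weak_star_def topspace_pullback_topology)
  have "continuous_map euclidean norm_weak_star (\<lambda>y. (y, 0 :: 'a \<Rightarrow>\<^sub>L real))"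
    unfolding norm_weak_star_def by (simp add: continuous_map_pairwise o_def UN)
  from continuous_map_compose[OF this lc]
  have 1: "continuous_on UNIV (\<lambda>y. l (y, 0))" by (simp add: o_def)
  have "continuous_map weak_star norm_weak_star (\<lambda>ys. (0, ys))"
    unfolding norm_weak_star_def by (simp add: continuous_map_pairwise o_def)
  from continuous_map_compose[OF this lc]
  have 2: "continuous_map weak_star euclideanreal (\<lambda>ys. l (0, ys))" by (simp add: o_def)
  have "linear (\<lambda>y. l (y, 0))" "linear (\<lambda>ys. l (0, ys))"
    using linear_compose[of "\<lambda>y. (y, 0)", OF _ l] linear_compose[of "\<lambda>ys. (0, ys)", OF _ l]
    by (auto simp: o_def linear_iff)
  then have bl: "bounded_linear (\<lambda>y. l (y, 0))" and "\<exists>x. \<forall>ys. l (0, ys) = blinfun_apply ys x"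
    using continuous_linear_bounded[OF _ 1] weak_star_continuous_linear[OF _ 2] by auto
  then obtain x where x: "\<And>ys. l (0, ys) = blinfun_apply ys x" by blast
  have "g (y, ys) = blinfun_apply (Blinfun (\<lambda>y. l (y, 0))) y + blinfun_apply ys x + c" for y ys
    using linear_add[OF l, of "(y, 0)" "(0, ys)"] by (simp add: g x bounded_linear_Blinfun_apply[OF bl])
  then show ?thesis by blast
qed

section \<open>Extended real arithmetic and convex functions\<close>

lemma ereal_diff_le_swap: "ereal s - a \<le> b \<longleftrightarrow> ereal s - b \<le> a"
  by (cases a; cases b) auto

lemma ereal_diff_le_real_iff: "ereal s - a \<le> ereal r \<longleftrightarrow> ereal (s - r) \<le> a"
  by (cases a) auto

text \<open>Approximating \<open>a\<close> by real upper bounds avoids a separate treatment of the value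
\<open>-\<infinity>\<close> of \<open>a\<close>.\<close>

lemma ereal_diff_leI:
  assumes "\<And>r. a \<le> ereal r \<Longrightarrow> ereal (s - r) \<le> c"
  shows "ereal s - a \<le> c"
proof (cases a)
  case MInf
  then have "ereal b \<le> c" for b using assms[of "s - b"] by simp
  then have "c = \<infinity>" by (rule ereal_top)
  then show ?thesis by simp
qed (use assms in auto)

lemma ereal_convex_bound_le:
  assumes "ereal a \<le> e" "ereal b \<le> e" "u \<ge> 0" "v \<ge> 0" "u + v = 1"
  shows "ereal (u * a + v * b) \<le> e"
  using assms convex_bound_le[of a _ b u v] by (cases e) auto

lemma convex_funI:
  assumes "\<And>x y a b u v. f x \<le> ereal a \<Longrightarrow> f y \<le> ereal b \<Longrightarrow> u \<ge> 0 \<Longrightarrow> v \<ge> 0 \<Longrightarrow> u + v = 1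
    \<Longrightarrow> f (u *\<^sub>R x + v *\<^sub>R y) \<le> ereal (u * a + v * b)"
  shows "convex_fun f"
  unfolding convex_fun_def convex_def using assms by auto

lemma convex_funD:
  assumes "convex_fun f" "f x \<le> ereal a" "f y \<le> ereal b" "u \<ge> 0" "v \<ge> 0" "u + v = 1"
  shows "f (u *\<^sub>R x + v *\<^sub>R y) \<le> ereal (u * a + v * b)"
  using convexD[OF assms(1)[unfolded convex_fun_def], of "(x, a)" "(y, b)" u v] assms(2-) by simp

lemma fun_closure_le: "fun_closure \<tau> f x \<le> f x"
  unfolding fun_closure_def by (rule SUP_least) auto

section \<open>Conjugates and partial conjugates\<close>

lemma conjugate_le_iff:
  "conjugate \<phi> (xs, x) \<le> ereal r
    \<longleftrightarrow> (\<forall>y ys. ereal (blinfun_apply xs y + blinfun_apply ys x - r) \<le> \<phi> (y, ys))"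
  by (simp add: conjugate_def SUP_le_iff ereal_diff_le_real_iff)

lemma fenchel_young:
  "ereal (blinfun_apply xs y + blinfun_apply ys x) - \<phi> (y, ys) \<le> conjugate \<phi> (xs, x)"
  unfolding conjugate_def prod.case by (rule SUP_upper2[of "(y, ys)"]) auto

lemma convex_conjugate: "convex_fun (conjugate \<phi>)"
proof (rule convex_funI)
  fix p q :: "('a \<Rightarrow>\<^sub>L real) \<times> 'a" and a b u v :: real
  assume uv: "u \<ge> 0" "v \<ge> 0" "u + v = 1"
    and pq: "conjugate \<phi> p \<le> ereal a" "conjugate \<phi> q \<le> ereal b"
  obtain xs x zs z where p: "p = (xs, x)" "q = (zs, z)" by (cases p, cases q)
  have "ereal (blinfun_apply (u *\<^sub>R xs + v *\<^sub>R zs) y + blinfun_apply ys (u *\<^sub>R x + v *\<^sub>R z)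
      - (u * a + v * b)) \<le> \<phi> (y, ys)" for y ys
  proof -
    let ?A = "blinfun_apply xs y + blinfun_apply ys x - a"
    let ?B = "blinfun_apply zs y + blinfun_apply ys z - b"
    have "ereal ?A \<le> \<phi> (y, ys)" "ereal ?B \<le> \<phi> (y, ys)"
      using pq by (simp_all add: p conjugate_le_iff)
    then have "ereal (u * ?A + v * ?B) \<le> \<phi> (y, ys)"
      using uv by (rule ereal_convex_bound_le)
    moreover have "u * ?A + v * ?B = blinfun_apply (u *\<^sub>R xs + v *\<^sub>R zs) y
        + blinfun_apply ys (u *\<^sub>R x + v *\<^sub>R z) - (u * a + v * b)"
      by (simp add: blinfun.add_left blinfun.scaleR_left blinfun.add_right blinfun.scaleR_right
          algebra_simps)
    ultimately show ?thesis by simp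
  qed
  then show "conjugate \<phi> (u *\<^sub>R p + v *\<^sub>R q) \<le> ereal (u * a + v * b)"
    by (simp add: p conjugate_le_iff)
qed

text \<open>For \<open>\<psi> = \<phi>\<^sup>*\<close> this is the bifunction that represents the operator:
the conjugate is taken in the dual variable, with the other variable as a parameter.\<close>

definition partial_conjugate ::
    "(('a::real_normed_vector \<Rightarrow>\<^sub>L real) \<times> 'a \<Rightarrow> ereal) \<Rightarrow> 'a \<Rightarrow> 'a \<Rightarrow> ereal" where
  "partial_conjugate \<psi> x y = (SUP xs. ereal (blinfun_apply xs y) - \<psi> (xs, x))"

lemma partial_conjugate_upper:
  "ereal (blinfun_apply xs y) - \<psi> (xs, x) \<le> partial_conjugate \<psi> x y"
  unfolding partial_conjugate_def by (rule SUP_upper) simp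

lemma partial_conjugate_ge:
  assumes "\<psi> (xs, x) \<le> ereal r"
  shows "ereal (blinfun_apply xs y - r) \<le> partial_conjugate \<psi> x y"
proof -
  have "ereal (blinfun_apply xs y - r) \<le> ereal (blinfun_apply xs y) - \<psi> (xs, x)"
    using assms by (cases "\<psi> (xs, x)") auto
  also have "\<dots> \<le> partial_conjugate \<psi> x y" by (rule partial_conjugate_upper)
  finally show ?thesis .
qed

lemma partial_conjugate_le_iff:
  "partial_conjugate \<psi> x y \<le> ereal r \<longleftrightarrow> (\<forall>xs. ereal (blinfun_apply xs y - r) \<le> \<psi> (xs, x))"
  by (simp add: partial_conjugate_def SUP_le_iff ereal_diff_le_real_iff)

lemma convex_partial_conjugate: "convex_fun (partial_conjugate \<psi> x)"
proof (rule convex_funI)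
  fix y z :: 'a and a b u v :: real
  assume uv: "u \<ge> 0" "v \<ge> 0" "u + v = 1"
    and yz: "partial_conjugate \<psi> x y \<le> ereal a" "partial_conjugate \<psi> x z \<le> ereal b"
  have "ereal (blinfun_apply xs (u *\<^sub>R y + v *\<^sub>R z) - (u * a + v * b)) \<le> \<psi> (xs, x)" for xs
  proof -
    let ?A = "blinfun_apply xs y - a" and ?B = "blinfun_apply xs z - b"
    have "ereal ?A \<le> \<psi> (xs, x)" "ereal ?B \<le> \<psi> (xs, x)"
      using yz by (simp_all add: partial_conjugate_le_iff)
    then have "ereal (u * ?A + v * ?B) \<le> \<psi> (xs, x)"
      using uv by (rule ereal_convex_bound_le)
    moreover have "u * ?A + v * ?B = blinfun_apply xs (u *\<^sub>R y + v *\<^sub>R z) - (u * a + v * b)"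
      by (simp add: blinfun.add_right blinfun.scaleR_right algebra_simps)
    ultimately show ?thesis by simp
  qed
  then show "partial_conjugate \<psi> x (u *\<^sub>R y + v *\<^sub>R z) \<le> ereal (u * a + v * b)"
    by (simp add: partial_conjugate_le_iff)
qed

text \<open>The negative of the function is the marginal \<open>inf \<psi> (xs, x) - xs y\<close> over
\<open>xs\<close> of a jointly convex function. As the infimum need not be attained, the convexity
inequality is derived for \<open>e\<close>-optimal functionals and then \<open>e\<close> tends to
\<open>0\<close>.\<close>

lemma concave_partial_conjugate:
  assumes \<psi>: "convex_fun \<psi>"
  shows "concave_fun (\<lambda>x. partial_conjugate \<psi> x y)"
  unfolding concave_fun_def
proof (rule convex_funI)
  fix x z :: 'a and a b u v :: real
  assume uv: "u \<ge> 0" "v \<ge> 0" "u + v = 1"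
    and xz: "- partial_conjugate \<psi> x y \<le> ereal a" "- partial_conjugate \<psi> z y \<le> ereal b"
  have near: "\<exists>ws. \<psi> (ws, w) \<le> ereal (blinfun_apply ws y + c + e)"
    if "- partial_conjugate \<psi> w y \<le> ereal c" "e > 0" for w c e
  proof -
    have "ereal (- c - e) < ereal (- c)" using that(2) by simp
    also have "ereal (- c) \<le> partial_conjugate \<psi> w y"
      using that(1) by (simp add: ereal_uminus_le_reorder)
    finally obtain ws where "ereal (- c - e) < ereal (blinfun_apply ws y) - \<psi> (ws, w)"
      by (auto simp: partial_conjugate_def less_SUP_iff)
    then show ?thesis by (intro exI[of _ ws]) (cases "\<psi> (ws, w)"; simp)
  qed
  show "- partial_conjugate \<psi> (u *\<^sub>R x + v *\<^sub>R z) y \<le> ereal (u * a + v * b)"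
  proof (rule ereal_le_epsilon2)
    fix e :: real assume e: "e > 0"
    obtain xs zs where "\<psi> (xs, x) \<le> ereal (blinfun_apply xs y + a + e)"
        "\<psi> (zs, z) \<le> ereal (blinfun_apply zs y + b + e)"
      using near[OF xz(1) e] near[OF xz(2) e] by blast
    from convex_funD[OF \<psi> this uv]
    have "ereal (blinfun_apply (u *\<^sub>R xs + v *\<^sub>R zs) y
        - (u * (blinfun_apply xs y + a + e) + v * (blinfun_apply zs y + b + e)))
      \<le> partial_conjugate \<psi> (u *\<^sub>R x + v *\<^sub>R z) y"
      by (intro partial_conjugate_ge) simp
    moreover have "blinfun_apply (u *\<^sub>R xs + v *\<^sub>R zs) y
        - (u * (blinfun_apply xs y + a + e) + v * (blinfun_apply zs y + b + e))
      = - (u * a + v * b + (u + v) * e)"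
      by (simp add: blinfun.add_left blinfun.scaleR_left algebra_simps)
    ultimately have "ereal (- (u * a + v * b + e)) \<le> partial_conjugate \<psi> (u *\<^sub>R x + v *\<^sub>R z) y"
      using uv(3) by simp
    then show "- partial_conjugate \<psi> (u *\<^sub>R x + v *\<^sub>R z) y \<le> ereal (u * a + v * b) + ereal e"
      by (cases "partial_conjugate \<psi> (u *\<^sub>R x + v *\<^sub>R z) y") auto
  qed
qed

text \<open>Each function \<open>y \<mapsto> xs y - r\<close> with \<open>r \<ge> \<psi> (xs, x)\<close> is
a continuous affine minorant, and by construction the partial conjugate is the supremum of such
functions.\<close>

lemma cl2_partial_conjugate: "cl2 (partial_conjugate \<psi>) = partial_conjugate \<psi>"
proof (intro ext antisym)
  fix x y
  show "cl2 (partial_conjugate \<psi>) x y \<le> partial_conjugate \<psi> x y"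
    unfolding cl2_def by (rule fun_closure_le)
  show "partial_conjugate \<psi> x y \<le> cl2 (partial_conjugate \<psi>) x y"
    unfolding partial_conjugate_def[of \<psi> x y]
  proof (intro SUP_least ereal_diff_leI)
    fix xs r assume r: "\<psi> (xs, x) \<le> ereal r"
    let ?g = "\<lambda>y. blinfun_apply xs y - r"
    have "affine_fun ?g"
      unfolding affine_fun_def
      by (intro exI[of _ "blinfun_apply xs"] exI[of _ "- r"])
        (simp add: bounded_linear.linear[OF blinfun.bounded_linear_right])
    moreover have "continuous_map euclidean euclideanreal ?g"
      by (auto intro!: continuous_intros)
    ultimately show "ereal (?g y) \<le> cl2 (partial_conjugate \<psi>) x y"
      unfolding cl2_def fun_closure_def using partial_conjugate_ge[of \<psi> xs x r, OF r]
      by (intro SUP_upper2[of ?g]) auto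
  qed
qed

text \<open>The right-hand side is free of \<open>y\<close>, which is what makes the bifunction
normal.\<close>

lemma partial_conjugate_eq_MInf_iff:
  "partial_conjugate \<psi> x y = -\<infinity> \<longleftrightarrow> (\<forall>xs. \<psi> (xs, x) = \<infinity>)"
proof -
  have "partial_conjugate \<psi> x y = -\<infinity> \<longleftrightarrow> (\<forall>xs. ereal (blinfun_apply xs y) - \<psi> (xs, x) = -\<infinity>)"
    unfolding partial_conjugate_def bot_ereal_def[symmetric] by (auto simp: SUP_bot_conv)
  moreover have "ereal s - e = -\<infinity> \<longleftrightarrow> e = \<infinity>" for s e by (cases e) auto
  ultimately show ?thesis by simp
qed

lemma bif_dom_eqI:
  assumes "C \<noteq> {}" "\<And>x y. F x y = -\<infinity> \<longleftrightarrow> x \<notin> C"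
  shows "normal_bif F" "bif_dom F = C"
proof -
  show "normal_bif F" using assms unfolding normal_bif_def by blast
  show "bif_dom F = C"
    unfolding bif_dom_def by (rule the_equality) (use assms in auto)
qed

section \<open>The Fitzpatrick transforms of the partial conjugate\<close>

text \<open>The transform is the biconjugate of \<open>\<lambda>xs. \<phi>\<^sup>* (xs, x)\<close> for the
duality between \<open>X\<^sup>*\<close> and \<open>X\<close>. This function is by definition a supremum of
affine functions that are evaluations at points \<open>y\<close> of \<open>X\<close> up to constants, so
biconjugation does not lose anything: the term of \<open>\<phi>\<^sup>*\<close> indexed by
\<open>(y, ys)\<close> lies below the term of the transform indexed by \<open>y\<close>, by the
Fenchel--Young inequality.\<close>

lemma upper_fitzpatrick_partial_conjugate:
  "upper_fitzpatrick (partial_conjugate (conjugate \<phi>)) = (\<lambda>(x, xs). conjugate \<phi> (xs, x))"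
proof (rule ext, clarify)
  fix x :: 'a and xs
  let ?F = "partial_conjugate (conjugate \<phi>)"
  show "upper_fitzpatrick ?F (x, xs) = conjugate \<phi> (xs, x)"
  proof (rule antisym)
    show "upper_fitzpatrick ?F (x, xs) \<le> conjugate \<phi> (xs, x)"
      unfolding upper_fitzpatrick_def prod.case
      by (rule SUP_least) (simp add: ereal_diff_le_swap[of _ "?F x _"] partial_conjugate_upper)
    have "(SUP (y, ys) \<in> UNIV. ereal (blinfun_apply xs y + blinfun_apply ys x) - \<phi> (y, ys))
        \<le> upper_fitzpatrick ?F (x, xs)"
    proof (rule SUP_least)
      fix p :: "'a \<times> ('a \<Rightarrow>\<^sub>L real)"
      obtain y ys where p: "p = (y, ys)" by (cases p)
      have "ereal (blinfun_apply zs y) - conjugate \<phi> (zs, x) \<le> \<phi> (y, ys) - ereal (blinfun_apply ys x)"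
        for zs
        using fenchel_young[of zs y ys x \<phi>]
        by (cases "\<phi> (y, ys)"; cases "conjugate \<phi> (zs, x)") auto
      then have "?F x y \<le> \<phi> (y, ys) - ereal (blinfun_apply ys x)"
        unfolding partial_conjugate_def by (rule SUP_least)
      then have "ereal (blinfun_apply xs y + blinfun_apply ys x) - \<phi> (y, ys)
          \<le> ereal (blinfun_apply xs y) - ?F x y"
        by (cases "\<phi> (y, ys)"; cases "?F x y") auto
      also have "\<dots> \<le> upper_fitzpatrick ?F (x, xs)"
        unfolding upper_fitzpatrick_def prod.case by (rule SUP_upper) simp
      finally show "(case p of (y, ys) \<Rightarrow> ereal (blinfun_apply xs y + blinfun_apply ys x) - \<phi> (y, ys))
          \<le> upper_fitzpatrick ?F (x, xs)" by (simp add: p)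
    qed
    then show "conjugate \<phi> (xs, x) \<le> upper_fitzpatrick ?F (x, xs)" by (simp add: conjugate_def)
  qed
qed

text \<open>Here the transform is the full biconjugate \<open>\<phi>\<^sup>*\<^sup>*\<close>. A continuous
affine minorant of \<open>\<phi>\<close> has the form \<open>(y, ys) \<mapsto> ws y + ys w + c\<close>, so
it bears witness that \<open>\<phi>\<^sup>* (ws, w) \<le> - c\<close> and is therefore also a minorant of
\<open>\<phi>\<^sup>*\<^sup>*\<close>.\<close>

lemma fitzpatrick_partial_conjugate:
  assumes "closed_fun norm_weak_star \<phi>"
  shows "fitzpatrick (partial_conjugate (conjugate \<phi>)) = \<phi>"
proof (rule ext, clarify)
  fix x :: 'a and xs
  let ?F = "partial_conjugate (conjugate \<phi>)"
  show "fitzpatrick ?F (x, xs) = \<phi> (x, xs)"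
  proof (rule antisym)
    show "fitzpatrick ?F (x, xs) \<le> \<phi> (x, xs)"
      unfolding fitzpatrick_def prod.case
    proof (rule SUP_least)
      fix y
      have "ereal (blinfun_apply ys x) - conjugate \<phi> (ys, y) \<le> \<phi> (x, xs) - ereal (blinfun_apply xs y)"
        for ys
        using fenchel_young[of ys x xs y \<phi>]
        by (cases "\<phi> (x, xs)"; cases "conjugate \<phi> (ys, y)") auto
      then have "?F y x \<le> \<phi> (x, xs) - ereal (blinfun_apply xs y)"
        unfolding partial_conjugate_def by (rule SUP_least)
      then show "ereal (blinfun_apply xs y) + ?F y x \<le> \<phi> (x, xs)"
        by (cases "\<phi> (x, xs)"; cases "?F y x") auto
    qed
    have "fun_closure norm_weak_star \<phi> (x, xs) \<le> fitzpatrick ?F (x, xs)"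
      unfolding fun_closure_def
    proof (rule SUP_least, clarify)
      fix g :: "'a \<times> ('a \<Rightarrow>\<^sub>L real) \<Rightarrow> real"
      assume g: "affine_fun g" "continuous_map norm_weak_star euclideanreal g"
        and le: "\<forall>z. ereal (g z) \<le> \<phi> z"
      obtain ws w c where gw: "\<And>y ys. g (y, ys) = blinfun_apply ws y + blinfun_apply ys w + c"
        using continuous_affine_norm_weak_star[OF g] by blast
      have "conjugate \<phi> (ws, w) \<le> ereal (- c)"
        using le by (simp add: conjugate_le_iff gw[symmetric])
      then have "ereal (blinfun_apply ws x + c) \<le> ?F w x"
        using partial_conjugate_ge[of "conjugate \<phi>" ws w "- c" x] by simp
      then have "ereal (g (x, xs)) \<le> ereal (blinfun_apply xs w) + ?F w x"
        by (cases "?F w x") (auto simp: gw)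
      also have "\<dots> \<le> fitzpatrick ?F (x, xs)"
        unfolding fitzpatrick_def prod.case by (rule SUP_upper) simp
      finally show "ereal (g (x, xs)) \<le> fitzpatrick ?F (x, xs)" .
    qed
    then show "\<phi> (x, xs) \<le> fitzpatrick ?F (x, xs)"
      using assms by (simp add: closed_fun_def)
  qed
qed

text \<open>Moving the terms that do not depend on \<open>y\<close> to one side turns membership in the
operators of a bifunction into a comparison of its transforms with the duality product.\<close>

lemma right_op_iff:
  "xs \<in> right_op F x \<longleftrightarrow> upper_fitzpatrick F (x, xs) \<le> ereal (blinfun_apply xs x)"
proof -
  have "ereal (blinfun_apply xs (y - x)) \<le> F x y
      \<longleftrightarrow> ereal (blinfun_apply xs y) - F x y \<le> ereal (blinfun_apply xs x)" for y
    by (simp add: ereal_diff_le_real_iff blinfun.diff_right)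
  then show ?thesis by (simp add: right_op_def upper_fitzpatrick_def SUP_le_iff)
qed

lemma left_op_iff:
  "xs \<in> left_op F x \<longleftrightarrow> fitzpatrick F (x, xs) \<le> ereal (blinfun_apply xs x)"
proof -
  have "ereal (blinfun_apply xs (y - x)) \<le> - F y x
      \<longleftrightarrow> ereal (blinfun_apply xs y) + F y x \<le> ereal (blinfun_apply xs x)" for y
    by (cases "F y x") (auto simp: blinfun.diff_right)
  then show ?thesis by (simp add: left_op_def fitzpatrick_def SUP_le_iff)
qed

section \<open>Maximal monotone operators and their representative functions\<close>

lemma maximal_monotone_memI:
  assumes T: "maximal_monotone_op T"
    and rel: "\<And>y ys. ys \<in> T y \<Longrightarrow> 0 \<le> blinfun_apply (xs - ys) (x - y)"
  shows "xs \<in> T x"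
proof (rule ccontr)
  assume "xs \<notin> T x"
  let ?S = "T(x := insert xs (T x))"
  have T': "0 \<le> blinfun_apply (us - vs) (u - v)" if "us \<in> T u" "vs \<in> T v" for u v us vs
    using T that unfolding maximal_monotone_op_def monotone_op_def by blast
  have "0 \<le> blinfun_apply (ys - xs) (y - x)" if "ys \<in> T y" for y ys
    using rel[OF that] by (simp add: blinfun.diff_left blinfun.diff_right)
  then have "monotone_op ?S"
    unfolding monotone_op_def using T' rel by (auto split: if_splits)
  moreover have "gph T \<subset> gph ?S" using \<open>xs \<notin> T x\<close> by (auto simp: gph_def)
  ultimately show False using T unfolding maximal_monotone_op_def by blast
qed

text \<open>The supremum of the left-hand sides in the second hypothesis is the Fitzpatrick function of
\<open>T\<close> at \<open>(x, xs)\<close>. That it is at most \<open>xs x\<close> says precisely that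
\<open>(x, xs)\<close> is monotonically related to the graph. The intermediate value \<open>e\<close> is
meant for \<open>\<phi> (x, xs)\<close> and \<open>\<phi>\<^sup>* (xs, x)\<close>, which both dominate the
Fitzpatrick function.\<close>

lemma maximal_monotone_mem_of_bound:
  assumes T: "maximal_monotone_op T"
    and ge: "\<And>y ys. ys \<in> T y
      \<Longrightarrow> ereal (blinfun_apply xs y + blinfun_apply ys x - blinfun_apply ys y) \<le> e"
    and le: "e \<le> ereal (blinfun_apply xs x)"
  shows "xs \<in> T x"
proof (rule maximal_monotone_memI[OF T])
  fix y ys assume "ys \<in> T y"
  then have "ereal (blinfun_apply xs y + blinfun_apply ys x - blinfun_apply ys y)
      \<le> ereal (blinfun_apply xs x)"
    using ge le order_trans by blast
  then show "0 \<le> blinfun_apply (xs - ys) (x - y)"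
    by (simp add: blinfun.diff_left blinfun.diff_right)
qed

text \<open>The hypothesis says that the Fitzpatrick function of \<open>T\<close> is finite at
\<open>(x, xs)\<close>. If \<open>x\<close> were at positive distance from the convex hull of the domain, a
functional \<open>u\<close> would satisfy \<open>u (x - y) \<ge> \<delta> > 0\<close> for all
\<open>y\<close> in the domain. Adding a large multiple of \<open>u\<close> to \<open>xs\<close> would then
make the pair monotonically related to the graph, so that maximality would put \<open>x\<close> into the
domain.\<close>

lemma maximal_monotone_bound_imp_closure_dom:
  assumes T: "maximal_monotone_op T"
    and bd: "\<And>y ys. ys \<in> T y
      \<Longrightarrow> blinfun_apply xs y + blinfun_apply ys x - blinfun_apply ys y \<le> r"
  shows "x \<in> closure (convex hull (op_dom T))"
proof (rule ccontr)
  assume x: "x \<notin> closure (convex hull (op_dom T))"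
  obtain u :: "'a \<Rightarrow>\<^sub>L real" and \<delta> where u: "\<delta> > 0"
      "\<And>y. y \<in> closure (convex hull (op_dom T)) \<Longrightarrow> \<delta> \<le> blinfun_apply u (x - y)"
    by (rule separate_point_closed_convex[OF _ _ x]) (auto intro: convex_closure convex_convex_hull)
  have sub: "op_dom T \<subseteq> closure (convex hull (op_dom T))"
    using hull_subset closure_subset by (rule order_trans)
  \<comment> \<open>Large enough for \<open>t \<delta>\<close> to compensate the excess of \<open>r\<close> over \<open>xs x\<close>.\<close>
  define t where "t = max 0 ((r - blinfun_apply xs x) / \<delta>)"
  have t: "t \<ge> 0" "r - blinfun_apply xs x \<le> t * \<delta>"
    using u(1) by (auto simp: t_def field_simps max_def)
  have "xs + t *\<^sub>R u \<in> T x"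
  proof (rule maximal_monotone_memI[OF T])
    fix y ys assume ys: "ys \<in> T y"
    then have "y \<in> closure (convex hull (op_dom T))"
      using sub by (auto simp: op_dom_def)
    then have "t * \<delta> \<le> t * blinfun_apply u (x - y)" using u(2) t(1) by (simp add: mult_left_mono)
    then show "0 \<le> blinfun_apply (xs + t *\<^sub>R u - ys) (x - y)"
      using bd[OF ys] t(2)
      by (simp add: blinfun.diff_left blinfun.diff_right blinfun.add_left blinfun.scaleR_left
          algebra_simps)
  qed
  then show False using x sub by (auto simp: op_dom_def)
qed

text \<open>Every representative function dominates the Fitzpatrick function of \<open>T\<close>. Along the
segment from a graph point \<open>(x, xs)\<close> to \<open>(y, ys)\<close>, convexity bounds
\<open>\<phi>\<close> from above by a function affine in \<open>t\<close>, and \<open>\<phi>\<close> is at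
least the duality product, which is quadratic in \<open>t\<close>. Both bounds agree at
\<open>t = 0\<close>, so their slopes there compare; this is the claim.\<close>

lemma representative_ge:
  assumes \<phi>: "\<phi> \<in> representatives T" and xs: "xs \<in> T x"
  shows "ereal (blinfun_apply xs y + blinfun_apply ys x - blinfun_apply xs x) \<le> \<phi> (y, ys)"
proof (cases "\<phi> (y, ys)")
  case (real r)
  let ?A = "blinfun_apply xs y + blinfun_apply ys x" and ?B = "blinfun_apply ys y"
    and ?C = "blinfun_apply xs x"
  have ge: "\<And>z zs. ereal (blinfun_apply zs z) \<le> \<phi> (z, zs)" and conv: "convex_fun \<phi>"
    and eq: "\<phi> (x, xs) = ereal ?C"
    using \<phi> xs by (auto simp: representatives_def gph_def)
  have *: "?A - ?C + t * (?B - ?A + ?C) \<le> r" if t: "0 < t" "t < 1" for t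
  proof -
    let ?z = "(1 - t) *\<^sub>R x + t *\<^sub>R y" and ?zs = "(1 - t) *\<^sub>R xs + t *\<^sub>R ys"
    have "ereal (blinfun_apply ?zs ?z) \<le> \<phi> (?z, ?zs)" by (rule ge)
    also have "\<dots> \<le> ereal ((1 - t) * ?C + t * r)"
      using convex_funD[OF conv, of "(x, xs)" ?C "(y, ys)" r "1 - t" t] eq real t by simp
    finally have "blinfun_apply ?zs ?z \<le> (1 - t) * ?C + t * r" by simp
    moreover have "blinfun_apply ?zs ?z
        = (1 - t) * ?C + t * (?A - ?C + t * (?B - ?A + ?C))"
      unfolding blinfun.add_left blinfun.add_right blinfun.scaleR_left blinfun.scaleR_right
      by (simp add: algebra_simps)
    \<comment> \<open>The term \<open>(1 - t) xs x\<close> is common to both bounds and cancels; the rest is divisible by \<open>t\<close>.\<close>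
    ultimately have "t * (?A - ?C + t * (?B - ?A + ?C)) \<le> t * r" by simp
    then show ?thesis using t by simp
  qed
  have "((\<lambda>t. ?A - ?C + t * (?B - ?A + ?C)) \<longlongrightarrow> ?A - ?C + 0 * (?B - ?A + ?C)) (at_right 0)"
    by (intro tendsto_intros)
  moreover have "\<forall>\<^sub>F t in at_right 0. ?A - ?C + t * (?B - ?A + ?C) \<le> r"
    using * by (auto simp: eventually_at_right_field intro: exI[of _ 1])
  ultimately have "?A - ?C + 0 * (?B - ?A + ?C) \<le> r"
    by (rule tendsto_upperbound) simp
  then show ?thesis using real by simp
next
  case MInf
  have "ereal (blinfun_apply ys y) \<le> \<phi> (y, ys)" using \<phi> by (simp add: representatives_def)
  then show ?thesis using MInf by simp
qed simp

lemma conjugate_representative_ge: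
  assumes "\<phi> \<in> representatives T" "ys \<in> T y"
  shows "ereal (blinfun_apply xs y + blinfun_apply ys x - blinfun_apply ys y) \<le> conjugate \<phi> (xs, x)"
proof -
  have "\<phi> (y, ys) = ereal (blinfun_apply ys y)"
    using assms by (auto simp: representatives_def gph_def)
  then show ?thesis using fenchel_young[of xs y ys x \<phi>] by simp
qed

text \<open>Off the graph, \<open>\<phi>\<close> exceeds the duality product strictly: it dominates the
Fitzpatrick function, which does so by maximality.\<close>

lemma representative_le_iff:
  assumes "maximal_monotone_op T" "\<phi> \<in> representatives T"
  shows "\<phi> (x, xs) \<le> ereal (blinfun_apply xs x) \<longleftrightarrow> xs \<in> T x"
proof
  assume "\<phi> (x, xs) \<le> ereal (blinfun_apply xs x)"
  then show "xs \<in> T x"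
    using representative_ge[OF assms(2)]
    by (intro maximal_monotone_mem_of_bound[OF assms(1), of xs x "\<phi> (x, xs)"])
      (auto simp: add.commute)
next
  assume "xs \<in> T x"
  then show "\<phi> (x, xs) \<le> ereal (blinfun_apply xs x)"
    using assms(2) by (auto simp: representatives_def gph_def)
qed

text \<open>On the graph, the supremum that defines \<open>\<phi>\<^sup>*\<close> is at most
\<open>xs x\<close> by a rearrangement of \<open>representative_ge\<close>. Conversely,
\<open>\<phi>\<^sup>*\<close> dominates the Fitzpatrick function, so maximality applies.\<close>

lemma conjugate_representative_le_iff:
  assumes "maximal_monotone_op T" "\<phi> \<in> representatives T"
  shows "conjugate \<phi> (xs, x) \<le> ereal (blinfun_apply xs x) \<longleftrightarrow> xs \<in> T x"
proof
  assume "conjugate \<phi> (xs, x) \<le> ereal (blinfun_apply xs x)"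
  then show "xs \<in> T x"
    using conjugate_representative_ge[OF assms(2)]
    by (intro maximal_monotone_mem_of_bound[OF assms(1)])
next
  assume "xs \<in> T x"
  then show "conjugate \<phi> (xs, x) \<le> ereal (blinfun_apply xs x)"
    using representative_ge[OF assms(2)] by (simp add: conjugate_le_iff)
qed

lemma convex_dom_projection:
  assumes "convex_fun \<psi>"
  shows "convex {x. \<exists>xs. \<psi> (xs, x) \<noteq> \<infinity>}"
proof (rule convexI)
  fix x z and u v :: real
  assume xz: "x \<in> {x. \<exists>xs. \<psi> (xs, x) \<noteq> \<infinity>}" "z \<in> {x. \<exists>xs. \<psi> (xs, x) \<noteq> \<infinity>}"
    and uv: "0 \<le> u" "0 \<le> v" "u + v = 1"
  have real_bound: "\<exists>r. e \<le> ereal r" if "e \<noteq> \<infinity>" for e using that by (cases e) auto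
  obtain xs zs a b where "\<psi> (xs, x) \<le> ereal a" "\<psi> (zs, z) \<le> ereal b"
    using xz real_bound by blast
  from convex_funD[OF assms this uv]
  have "\<psi> (u *\<^sub>R xs + v *\<^sub>R zs, u *\<^sub>R x + v *\<^sub>R z) \<noteq> \<infinity>" by auto
  then show "u *\<^sub>R x + v *\<^sub>R z \<in> {x. \<exists>xs. \<psi> (xs, x) \<noteq> \<infinity>}" by blast
qed

lemma dom_conjugate_representative:
  assumes T: "maximal_monotone_op T" and \<phi>: "\<phi> \<in> representatives T"
  shows "convex hull (op_dom T) \<subseteq> {x. \<exists>xs. conjugate \<phi> (xs, x) \<noteq> \<infinity>}"
    and "{x. \<exists>xs. conjugate \<phi> (xs, x) \<noteq> \<infinity>} \<subseteq> closure (convex hull (op_dom T))"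
proof -
  have "op_dom T \<subseteq> {x. \<exists>xs. conjugate \<phi> (xs, x) \<noteq> \<infinity>}"
  proof
    fix x assume "x \<in> op_dom T"
    then obtain xs where "xs \<in> T x" by (auto simp: op_dom_def)
    then have "conjugate \<phi> (xs, x) \<le> ereal (blinfun_apply xs x)"
      by (simp add: conjugate_representative_le_iff[OF T \<phi>])
    then have "conjugate \<phi> (xs, x) \<noteq> \<infinity>" by auto
    then show "x \<in> {x. \<exists>xs. conjugate \<phi> (xs, x) \<noteq> \<infinity>}" by blast
  qed
  then show "convex hull (op_dom T) \<subseteq> {x. \<exists>xs. conjugate \<phi> (xs, x) \<noteq> \<infinity>}"
    by (rule hull_minimal) (rule convex_dom_projection[OF convex_conjugate])
next
  show "{x. \<exists>xs. conjugate \<phi> (xs, x) \<noteq> \<infinity>} \<subseteq> closure (convex hull (op_dom T))"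
  proof clarify
    fix x xs assume fin: "conjugate \<phi> (xs, x) \<noteq> \<infinity>"
    then obtain r where "conjugate \<phi> (xs, x) \<le> ereal r"
      by (cases "conjugate \<phi> (xs, x)") auto
    then have "ereal (blinfun_apply xs y + blinfun_apply ys x - blinfun_apply ys y) \<le> ereal r"
      if "ys \<in> T y" for y ys
      by (rule order_trans[OF conjugate_representative_ge[OF \<phi> that]])
    then have "blinfun_apply xs y + blinfun_apply ys x - blinfun_apply ys y \<le> r"
      if "ys \<in> T y" for y ys
      using that by simp
    then show "x \<in> closure (convex hull (op_dom T))"
      by (rule maximal_monotone_bound_imp_closure_dom[OF T])
  qed
qed

section \<open>The bifunction of a representative function\<close>

theorem theorem5:
  fixes T :: "'a::banach \<Rightarrow> ('a \<Rightarrow>\<^sub>L real) set"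
    and \<phi> :: "'a \<times> ('a \<Rightarrow>\<^sub>L real) \<Rightarrow> ereal"
    and F :: "'a \<Rightarrow> 'a \<Rightarrow> ereal"
  assumes "op_dom T \<noteq> {}"
    and "maximal_monotone_op T"
    and "\<phi> \<in> representatives T"
    and "\<And>x y. F x y = (SUP xs. ereal (blinfun_apply xs y) - conjugate \<phi> (xs, x))"
  shows "(saddle_fun F \<and> cl2 F = F)
    \<and> (normal_bif F \<and> convex hull (op_dom T) \<subseteq> bif_dom F
         \<and> bif_dom F \<subseteq> closure (convex hull (op_dom T)))
    \<and> (right_op F = T \<and> left_op F = T)
    \<and> (fitzpatrick F = \<phi> \<and> upper_fitzpatrick F = (\<lambda>(x, xs). conjugate \<phi> (xs, x)))"
proof -
  let ?C = "{x. \<exists>xs. conjugate \<phi> (xs, x) \<noteq> \<infinity>}"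
  have F: "F = partial_conjugate (conjugate \<phi>)"
    by (intro ext) (simp add: assms(4) partial_conjugate_def)
  have a: "saddle_fun F \<and> cl2 F = F"
    unfolding F saddle_fun_def
    by (simp add: convex_partial_conjugate concave_partial_conjugate[OF convex_conjugate]
        cl2_partial_conjugate)
  have C: "convex hull (op_dom T) \<subseteq> ?C" "?C \<subseteq> closure (convex hull (op_dom T))"
    using dom_conjugate_representative[OF assms(2,3)] by blast+
  have "?C \<noteq> {}" using C(1) assms(1) hull_subset[of "op_dom T" convex]
    by (metis subset_empty)
  then have b: "normal_bif F" "bif_dom F = ?C"
    by (rule bif_dom_eqI[where C = ?C]; simp add: F partial_conjugate_eq_MInf_iff)+
  have "closed_fun norm_weak_star \<phi>" using assms(3) by (simp add: representatives_def)
  then have d: "fitzpatrick F = \<phi>" "upper_fitzpatrick F = (\<lambda>(x, xs). conjugate \<phi> (xs, x))"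
    by (simp_all only: F fitzpatrick_partial_conjugate upper_fitzpatrick_partial_conjugate)
  have c: "right_op F = T" "left_op F = T"
    by (intro ext set_eqI;
        simp add: right_op_iff left_op_iff d representative_le_iff[OF assms(2,3)]
          conjugate_representative_le_iff[OF assms(2,3)])+
  show ?thesis unfolding b(2) using a b(1) C c d by blast
qed

end
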